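(* Let $\alpha$ be a continuous gauge seminorm on $L^\infty(\mathbb T)$ and let $g\in L^\alpha(\mathbb T)$. Then $\lim_{m(E)\to0^+}\alpha(g\chi_E)=0$.
   Context: $\mathbb T$ is the unit circle and $m$ is normalized arc length (Haar measure) on $\mathbb T$; functions equal a.e. are identified. A gauge seminorm is a seminorm $\alpha$ on $L^\infty(\mathbb T)$ with $\alpha(1)=1$ and $\alpha(|f|)=\alpha(f)$ for every $f\in L^\infty(\mathbb T)$. It is continuous if $\lim_{m(E)\to0^+}\alpha(\chi_E)=0$ (i.e. $m(E_n)\to0$ implies $\alpha(\chi_{E_n})\to0$). For any measurable $f:\mathbb T\to\mathbb C$ put $\alpha(f)=\sup\{\alpha(s):s\text{ a simple function},\ |s|\le|f|\}$. $\mathcal L^\alpha(\mathbb T)$ is the set of measurable $f$ with $\alpha(f)<\infty$, and $L^\alpha(\mathbb T)$ is the $\alpha$-closure of $L^\infty(\mathbb T)$ in $\mathcal L^\alpha(\mathbb T)$. *)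

theory Defs
  imports "HOL-Analysis.Analysis"
begin

text \<open>
  The circle is \<^term>\<open>sphere (0::complex) 1\<close>, and functions on it are functions
  \<^typ>\<open>complex \<Rightarrow> complex\<close> whose values off the circle play no role, since they lie outside the
  space of the measure. Normalized arc length is the image under \<^const>\<open>cis\<close> of the uniform
  distribution on one period; it is completed, so that measurable means Lebesgue measurable.
\<close>

definition arc_length :: "complex measure" where
  "arc_length =
     completion (distr (uniform_measure lborel {0..<2*pi}) (restrict_space borel (sphere 0 1)) cis)"

definition L_infinity :: "(complex \<Rightarrow> complex) set" where
  "L_infinity = {f \<in> borel_measurable arc_length. \<exists>C. AE z in arc_length. norm (f z) \<le> C}"

text \<open>
  Only the values of \<open>\<alpha>\<close> on \<^const>\<open>L_infinity\<close> are constrained. The a.e. clause says that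
  \<open>\<alpha>\<close> is a function on classes modulo a.e. equality.
\<close>

definition gauge_seminorm :: "((complex \<Rightarrow> complex) \<Rightarrow> real) \<Rightarrow> bool" where
  "gauge_seminorm \<alpha> \<longleftrightarrow>
     (\<forall>f\<in>L_infinity. \<forall>g\<in>L_infinity. (AE z in arc_length. f z = g z) \<longrightarrow> \<alpha> f = \<alpha> g) \<and>
     (\<forall>f\<in>L_infinity. 0 \<le> \<alpha> f) \<and>
     (\<forall>c. \<forall>f\<in>L_infinity. \<alpha> (\<lambda>z. c * f z) = norm c * \<alpha> f) \<and>
     (\<forall>f\<in>L_infinity. \<forall>g\<in>L_infinity. \<alpha> (\<lambda>z. f z + g z) \<le> \<alpha> f + \<alpha> g) \<and>
     \<alpha> (\<lambda>z. 1) = 1 \<and>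
     (\<forall>f\<in>L_infinity. \<alpha> (\<lambda>z. complex_of_real (norm (f z))) = \<alpha> f)"

definition continuous_gauge_seminorm :: "((complex \<Rightarrow> complex) \<Rightarrow> real) \<Rightarrow> bool" where
  "continuous_gauge_seminorm \<alpha> \<longleftrightarrow>
     gauge_seminorm \<alpha> \<and>
     (\<forall>E :: nat \<Rightarrow> complex set.
        (\<forall>n. E n \<in> sets arc_length) \<longrightarrow> (\<lambda>n. measure arc_length (E n)) \<longlonglongrightarrow> 0 \<longrightarrow>
        (\<lambda>n. \<alpha> (indicator (E n))) \<longlonglongrightarrow> 0)"

text \<open>
  The extension of \<open>\<alpha>\<close> to measurable functions, with values in \<open>[0, \<infinity>]\<close>. The inequality is
  between classes of functions, hence a.e.
\<close>

definition gauge_ext :: "((complex \<Rightarrow> complex) \<Rightarrow> real) \<Rightarrow> (complex \<Rightarrow> complex) \<Rightarrow> ennreal" where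
  "gauge_ext \<alpha> f =
     (SUP s \<in> {s. simple_function arc_length s \<and> (AE z in arc_length. norm (s z) \<le> norm (f z))}.
        ennreal (\<alpha> s))"

definition script_L :: "((complex \<Rightarrow> complex) \<Rightarrow> real) \<Rightarrow> (complex \<Rightarrow> complex) set" where
  "script_L \<alpha> = {f \<in> borel_measurable arc_length. gauge_ext \<alpha> f < \<infinity>}"

definition L_gauge :: "((complex \<Rightarrow> complex) \<Rightarrow> real) \<Rightarrow> (complex \<Rightarrow> complex) set" where
  "L_gauge \<alpha> =
     {f \<in> script_L \<alpha>. \<forall>\<epsilon>>0. \<exists>h\<in>L_infinity. gauge_ext \<alpha> (\<lambda>z. f z - h z) < \<epsilon>}"

lemma cis_measurable_arc:
  "cis \<in> measurable (uniform_measure lborel {0..<2*pi}) (restrict_space borel (sphere 0 1))"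
proof (rule measurable_restrict_space2)
  have "cis \<in> measurable borel borel"
    by (intro borel_measurable_continuous_onI continuous_intros)
  then show "cis \<in> measurable (uniform_measure lborel {0..<2*pi}) borel"
    by (simp cong: measurable_cong_sets)
qed auto

lemma space_arc_length: "space arc_length = sphere 0 1"
  by (simp add: arc_length_def space_restrict_space)

lemma emeasure_space_arc_length: "emeasure arc_length (space arc_length) = 1"
proof -
  let ?U = "uniform_measure lborel {0..<2*pi}"
  let ?D = "distr ?U (restrict_space borel (sphere 0 1)) cis"
  have U: "emeasure ?U (space ?U) = 1"
    by (subst emeasure_uniform_measure) (auto intro!: ennreal_divide_self)
  have "emeasure ?D (space ?D) = emeasure ?U (cis -` space ?D \<inter> space ?U)"
    using cis_measurable_arc by (metis emeasure_distr sets.top sets_distr)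
  also have "cis -` space ?D \<inter> space ?U = space ?U"
    by (auto simp: space_restrict_space)
  finally have "emeasure ?D (space ?D) = 1"
    using U by simp
  then show ?thesis
    unfolding arc_length_def space_completion by (subst emeasure_completion[OF sets.top[of ?D, THEN sets_completionI_sets]]) (simp only: main_part[OF sets.top])
qed

end

theory Submission
  imports Defs
begin

text \<open>
  A gauge seminorm is monotone in the modulus, because a value in \<open>[0, b]\<close> is the mean of two
  conjugate values of modulus \<open>b\<close>. Let \<open>h\<close> be essentially bounded by \<open>C\<close>, with \<open>g - h\<close> small. If \<open>s\<close>
  is simple and \<open>\<bar>s\<bar> \<le> \<bar>g\<bar> \<chi>\<^sub>E\<close>, then \<open>\<bar>s\<bar> = max (\<bar>s\<bar> - C) 0 + min \<bar>s\<bar> C\<close>, where the first term is simple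
  and dominated by \<open>\<bar>g - h\<bar>\<close>, and the second is dominated by \<open>C \<chi>\<^sub>E\<close>.
\<close>

lemma L_infinityI:
  assumes "f \<in> borel_measurable arc_length" "AE z in arc_length. norm (f z) \<le> C"
  shows "f \<in> L_infinity"
  using assms unfolding L_infinity_def by blast

text \<open>The axioms constrain \<open>\<alpha>\<close> only on \<open>L_infinity\<close>, so each
  simple function has to be placed there before they apply; its finite range supplies the
  bound.\<close>

lemma simple_function_L_infinity:
  assumes "simple_function arc_length s"
  shows "s \<in> L_infinity"
proof (rule L_infinityI)
  show "s \<in> borel_measurable arc_length"
    using assms by (rule borel_measurable_simple_function)
  have "finite ((\<lambda>z. norm (s z)) ` space arc_length)"
    using finite_imageI[OF simple_functionD(1)[OF assms], of norm] by (simp add: image_image)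
  then show "AE z in arc_length. norm (s z) \<le> Max ((\<lambda>z. norm (s z)) ` space arc_length)"
    by (intro AE_I2) auto
qed

lemma indicator_L_infinity:
  assumes "E \<in> sets arc_length"
  shows "indicator E \<in> L_infinity"
  using assms by (intro simple_function_L_infinity simple_function_indicator)

lemma gauge_seminorm_cong_AE:
  assumes "gauge_seminorm \<alpha>" "f \<in> L_infinity" "k \<in> L_infinity"
    and "AE z in arc_length. f z = k z"
  shows "\<alpha> f = \<alpha> k"
  by (rule mp[OF bspec[OF bspec[OF conjunct1[OF assms(1)[unfolded gauge_seminorm_def]]]]])
     (fact assms)+

lemma gauge_seminorm_nonneg:
  assumes "gauge_seminorm \<alpha>" "f \<in> L_infinity"
  shows "0 \<le> \<alpha> f"
proof -
  have "\<forall>f\<in>L_infinity. 0 \<le> \<alpha> f"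
    using assms(1) unfolding gauge_seminorm_def by (elim conjE)
  from bspec[OF this assms(2)] show ?thesis .
qed

lemma gauge_seminorm_scale:
  assumes "gauge_seminorm \<alpha>" "f \<in> L_infinity"
  shows "\<alpha> (\<lambda>z. c * f z) = norm c * \<alpha> f"
proof -
  have "\<forall>c. \<forall>f\<in>L_infinity. \<alpha> (\<lambda>z. c * f z) = norm c * \<alpha> f"
    using assms(1) unfolding gauge_seminorm_def by (elim conjE)
  from bspec[OF spec[OF this] assms(2)] show ?thesis .
qed

lemma gauge_seminorm_norm:
  assumes "gauge_seminorm \<alpha>" "f \<in> L_infinity"
  shows "\<alpha> (\<lambda>z. complex_of_real (norm (f z))) = \<alpha> f"
proof -
  have "\<forall>f\<in>L_infinity. \<alpha> (\<lambda>z. complex_of_real (norm (f z))) = \<alpha> f"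
    using assms(1) unfolding gauge_seminorm_def by (elim conjE)
  from bspec[OF this assms(2)] show ?thesis .
qed

lemma gauge_seminorm_triangle:
  assumes "gauge_seminorm \<alpha>" "f \<in> L_infinity" "k \<in> L_infinity"
  shows "\<alpha> (\<lambda>z. f z + k z) \<le> \<alpha> f + \<alpha> k"
proof -
  have "\<forall>f\<in>L_infinity. \<forall>k\<in>L_infinity. \<alpha> (\<lambda>z. f z + k z) \<le> \<alpha> f + \<alpha> k"
    using assms(1) unfolding gauge_seminorm_def by (elim conjE)
  from bspec[OF bspec[OF this assms(2)] assms(3)] show ?thesis .
qed

lemma norm_L_infinity:
  assumes "f \<in> L_infinity"
  shows "(\<lambda>z. complex_of_real (norm (f z))) \<in> L_infinity"
  using assms unfolding L_infinity_def by auto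

text \<open>Passing to the modulus reduces this to invariance under a.e. equality. It is what lets a
  function be replaced by another that differs from it only in phase.\<close>

lemma gauge_seminorm_norm_cong:
  assumes \<alpha>: "gauge_seminorm \<alpha>" and f: "f \<in> L_infinity" and k: "k \<in> L_infinity"
    and eq: "AE z in arc_length. norm (f z) = norm (k z)"
  shows "\<alpha> f = \<alpha> k"
proof -
  have "\<alpha> (\<lambda>z. complex_of_real (norm (f z))) = \<alpha> (\<lambda>z. complex_of_real (norm (k z)))"
    using \<alpha> norm_L_infinity[OF f] norm_L_infinity[OF k]
  proof (rule gauge_seminorm_cong_AE)
    show "AE z in arc_length. complex_of_real (norm (f z)) = complex_of_real (norm (k z))"
      using eq by eventually_elim simp
  qed
  then show ?thesis
    by (simp only: gauge_seminorm_norm[OF \<alpha> f] gauge_seminorm_norm[OF \<alpha> k])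
qed

lemma gauge_seminorm_mono:
  assumes \<alpha>: "gauge_seminorm \<alpha>" and f: "f \<in> L_infinity" and k: "k \<in> L_infinity"
    and le: "AE z in arc_length. norm (f z) \<le> norm (k z)"
  shows "\<alpha> f \<le> \<alpha> k"
proof -
  \<comment> \<open>The imaginary part lifts \<open>norm (f z)\<close> to modulus
    \<open>norm (k z)\<close> when \<open>c\<close> is 1 or -1. Both signs are handled together
    below through \<open>c\<^sup>2 = 1\<close>. The radicand is nonnegative only a.e., so the
    modulus of \<open>P c\<close> is known only a.e.\<close>
  define P where "P c z = Complex (norm (f z)) (c * sqrt ((norm (k z))\<^sup>2 - (norm (f z))\<^sup>2))" for c z
  have [measurable]: "f \<in> borel_measurable arc_length" "k \<in> borel_measurable arc_length"
    using f k by (auto simp: L_infinity_def)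
  obtain C where C: "AE z in arc_length. norm (k z) \<le> C"
    using k by (auto simp: L_infinity_def)
  have norm_P: "AE z in arc_length. norm (P c z) = norm (k z)" if "c\<^sup>2 = 1" for c
    using le
  proof eventually_elim
    case (elim z)
    then have "(norm (f z))\<^sup>2 \<le> (norm (k z))\<^sup>2"
      by (simp add: power_mono)
    then show ?case
      using that by (simp add: P_def cmod_def power_mult_distrib)
  qed
  have P: "P c \<in> L_infinity" if "c\<^sup>2 = 1" for c
  proof (rule L_infinityI)
    show "P c \<in> borel_measurable arc_length"
      unfolding P_def Complex_eq by measurable
    show "AE z in arc_length. norm (P c z) \<le> C"
      using norm_P[OF that] C by eventually_elim simp
  qed
  have minus_one_sq: "(- 1 :: real)\<^sup>2 = 1"
    by simp
  have half: "(\<lambda>z. (1/2) * P c z) \<in> L_infinity" if "c\<^sup>2 = 1" for c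
  proof (rule L_infinityI)
    show "(\<lambda>z. (1/2) * P c z) \<in> borel_measurable arc_length"
      using P[OF that] by (auto simp: L_infinity_def)
    show "AE z in arc_length. norm ((1/2) * P c z) \<le> C / 2"
      using norm_P[OF that] C by eventually_elim (simp add: norm_mult norm_divide)
  qed
  have \<alpha>_half: "\<alpha> (\<lambda>z. (1/2) * P c z) = \<alpha> k / 2" if "c\<^sup>2 = 1" for c
  proof -
    have "\<alpha> (\<lambda>z. (1/2) * P c z) = norm (1/2 :: complex) * \<alpha> (P c)"
      using \<alpha> P[OF that] by (rule gauge_seminorm_scale)
    also have "\<alpha> (P c) = \<alpha> k"
      using \<alpha> P[OF that] k norm_P[OF that] by (rule gauge_seminorm_norm_cong)
    finally show ?thesis by (simp add: norm_divide)
  qed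
  have "\<alpha> f = \<alpha> (\<lambda>z. complex_of_real (norm (f z)))"
    by (rule gauge_seminorm_norm[OF \<alpha> f, symmetric])
  \<comment> \<open>The imaginary parts cancel at every point, even where the radicand is negative,
    so this is an equality of functions.\<close>
  also have "\<dots> = \<alpha> (\<lambda>z. (1/2) * P 1 z + (1/2) * P (-1) z)"
    by (rule arg_cong[of _ _ \<alpha>], rule ext) (simp add: P_def complex_eq_iff)
  also have "\<dots> \<le> \<alpha> (\<lambda>z. (1/2) * P 1 z) + \<alpha> (\<lambda>z. (1/2) * P (-1) z)"
    using \<alpha> half[OF power_one] half[OF minus_one_sq] by (rule gauge_seminorm_triangle)
  also have "\<dots> = \<alpha> k"
    using \<alpha>_half[OF power_one] \<alpha>_half[OF minus_one_sq] by linarith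
  finally show ?thesis .
qed

text \<open>The first term on the right does not depend on \<open>E\<close>, and the second vanishes
  with \<open>\<alpha> (indicator E)\<close> for fixed \<open>C\<close>. Splitting each simple
  competitor, rather than \<open>g\<close>, needs only the triangle inequality for
  \<open>\<alpha>\<close> itself.\<close>

lemma gauge_ext_mult_indicator_le:
  assumes \<alpha>: "gauge_seminorm \<alpha>" and C: "AE z in arc_length. norm (h z) \<le> C" "0 \<le> C"
    and E: "E \<in> sets arc_length"
  shows "gauge_ext \<alpha> (\<lambda>z. g z * indicator E z)
           \<le> gauge_ext \<alpha> (\<lambda>z. g z - h z) + ennreal (C * \<alpha> (indicator E))"
  unfolding gauge_ext_def[of \<alpha> "\<lambda>z. g z * indicator E z"]
proof (rule SUP_least, clarify)
  fix s :: "complex \<Rightarrow> complex"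
  assume s: "simple_function arc_length s"
    and le: "AE z in arc_length. norm (s z) \<le> norm (g z * indicator E z)"
  \<comment> \<open>Truncating the modulus of \<open>s\<close> at height \<open>C\<close> keeps both
    pieces simple, which a splitting through \<open>g - h\<close> and \<open>h\<close> would
    not.\<close>
  define t where "t z = complex_of_real (max (norm (s z) - C) 0)" for z
  define u where "u z = complex_of_real (min (norm (s z)) C)" for z
  have t: "simple_function arc_length t" and u: "simple_function arc_length u"
    unfolding t_def u_def using s by (auto intro: simple_function_compose1)
  have CE: "(\<lambda>z. complex_of_real C * indicator E z) \<in> L_infinity"
    using E by (intro simple_function_L_infinity simple_function_mult simple_function_const
        simple_function_indicator)
  have \<alpha>_t: "ennreal (\<alpha> t) \<le> gauge_ext \<alpha> (\<lambda>z. g z - h z)"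
    unfolding gauge_ext_def
  proof (rule SUP_upper, intro CollectI conjI t)
    \<comment> \<open>On \<open>E\<close>, \<open>norm (s z) - C\<close> is at most
      \<open>norm (g z) - norm (h z)\<close>. Off \<open>E\<close>, \<open>s\<close> vanishes a.e.,
      and so does \<open>t\<close> because \<open>0 \<le> C\<close>.\<close>
    show "AE z in arc_length. norm (t z) \<le> norm (g z - h z)"
      using le C(1)
    proof eventually_elim
      case (elim z)
      show ?case
        using elim C(2) norm_triangle_ineq2[of "g z" "h z"]
        unfolding t_def norm_of_real
        by (auto simp: norm_mult intro: order_trans[OF _ norm_ge_zero] split: split_indicator_asm)
    qed
  qed
  \<comment> \<open>Again \<open>s\<close> vanishes a.e. off \<open>E\<close>, so \<open>u\<close>
    does too, while the truncation bounds it by \<open>C\<close> on \<open>E\<close>.\<close>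
  have "\<alpha> u \<le> \<alpha> (\<lambda>z. complex_of_real C * indicator E z)"
  proof (rule gauge_seminorm_mono[OF \<alpha> simple_function_L_infinity[OF u] CE])
    show "AE z in arc_length. norm (u z) \<le> norm (complex_of_real C * indicator E z)"
      using le
    proof eventually_elim
      case (elim z)
      then show ?case
        using C(2) by (auto simp: u_def norm_mult split: split_indicator_asm split_indicator)
    qed
  qed
  also have "\<dots> = norm (complex_of_real C) * \<alpha> (indicator E)"
    using \<alpha> indicator_L_infinity[OF E] by (rule gauge_seminorm_scale)
  finally have \<alpha>_u: "\<alpha> u \<le> C * \<alpha> (indicator E)"
    using C(2) by simp
  have "\<alpha> s = \<alpha> (\<lambda>z. complex_of_real (norm (s z)))"
    by (rule gauge_seminorm_norm[OF \<alpha> simple_function_L_infinity[OF s], symmetric])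
  also have "\<dots> = \<alpha> (\<lambda>z. t z + u z)"
    by (rule arg_cong[of _ _ \<alpha>], rule ext) (simp add: t_def u_def max_def min_def)
  also have "\<dots> \<le> \<alpha> t + \<alpha> u"
    using \<alpha> simple_function_L_infinity[OF t] simple_function_L_infinity[OF u]
    by (rule gauge_seminorm_triangle)
  finally have "ennreal (\<alpha> s) \<le> ennreal (\<alpha> t + C * \<alpha> (indicator E))"
    using \<alpha>_u by (intro ennreal_leI) simp
  also have "\<dots> = ennreal (\<alpha> t) + ennreal (C * \<alpha> (indicator E))"
    using gauge_seminorm_nonneg[OF \<alpha> simple_function_L_infinity[OF t]]
      gauge_seminorm_nonneg[OF \<alpha> indicator_L_infinity[OF E]] C(2)
    by simp
  also have "\<dots> \<le> gauge_ext \<alpha> (\<lambda>z. g z - h z) + ennreal (C * \<alpha> (indicator E))"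
    using \<alpha>_t by (rule add_right_mono)
  finally show "ennreal (\<alpha> s) \<le> \<dots>" .
qed

theorem theorem4p1:
  fixes \<alpha> :: "(complex \<Rightarrow> complex) \<Rightarrow> real"
    and g :: "complex \<Rightarrow> complex"
  assumes "continuous_gauge_seminorm \<alpha>"
    and "g \<in> L_gauge \<alpha>"
  shows "\<forall>E :: nat \<Rightarrow> complex set.
           (\<forall>n. E n \<in> sets arc_length) \<longrightarrow> (\<lambda>n. measure arc_length (E n)) \<longlonglongrightarrow> 0 \<longrightarrow>
           (\<lambda>n. gauge_ext \<alpha> (\<lambda>z. g z * indicator (E n) z)) \<longlonglongrightarrow> 0"
proof (intro allI impI)
  fix E :: "nat \<Rightarrow> complex set"
  assume E: "\<forall>n. E n \<in> sets arc_length" and lim: "(\<lambda>n. measure arc_length (E n)) \<longlonglongrightarrow> 0"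
  have \<alpha>: "gauge_seminorm \<alpha>" and \<alpha>_lim: "(\<lambda>n. \<alpha> (indicator (E n))) \<longlonglongrightarrow> 0"
    using assms(1) E lim unfolding continuous_gauge_seminorm_def by blast+
  show "(\<lambda>n. gauge_ext \<alpha> (\<lambda>z. g z * indicator (E n) z)) \<longlonglongrightarrow> 0"
  \<comment> \<open>No \<open>ennreal\<close> lies below 0, so only the upper bounds need an
    argument.\<close>
  proof (rule order_tendstoI)
    fix \<epsilon> :: ennreal assume "0 < \<epsilon>"
    then obtain h where h: "h \<in> L_infinity" and \<epsilon>: "gauge_ext \<alpha> (\<lambda>z. g z - h z) < \<epsilon>"
      using assms(2) unfolding L_gauge_def by blast
    obtain C where "AE z in arc_length. norm (h z) \<le> C"
      using h unfolding L_infinity_def by blast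
    \<comment> \<open>Enlarging the bound to \<open>max C 0\<close> provides the nonnegativity that
      the estimate requires.\<close>
    then have C: "AE z in arc_length. norm (h z) \<le> max C 0"
      by eventually_elim simp
    have "(\<lambda>n. max C 0 * \<alpha> (indicator (E n))) \<longlonglongrightarrow> 0"
      using tendsto_mult_right_zero[OF \<alpha>_lim] .
    \<comment> \<open>With \<open>h\<close> fixed, the bound converges to a limit strictly below
      \<open>\<epsilon>\<close>, so it is eventually below \<open>\<epsilon>\<close> without
      splitting \<open>\<epsilon>\<close> in two.\<close>
    then have "(\<lambda>n. gauge_ext \<alpha> (\<lambda>z. g z - h z) + ennreal (max C 0 * \<alpha> (indicator (E n))))
        \<longlonglongrightarrow> gauge_ext \<alpha> (\<lambda>z. g z - h z) + ennreal 0"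
      by (intro tendsto_add tendsto_const tendsto_ennrealI)
    then have "\<forall>\<^sub>F n in sequentially.
        gauge_ext \<alpha> (\<lambda>z. g z - h z) + ennreal (max C 0 * \<alpha> (indicator (E n))) < \<epsilon>"
      by (rule order_tendstoD) (simp add: \<epsilon>)
    then show "\<forall>\<^sub>F n in sequentially. gauge_ext \<alpha> (\<lambda>z. g z * indicator (E n) z) < \<epsilon>"
      by eventually_elim (use gauge_ext_mult_indicator_le[OF \<alpha> C] E in \<open>auto intro: le_less_trans\<close>)
  qed simp
qed

end
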